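(* Let $V$ be a vector space over a field $k$ with a direct sum decomposition $V=\bigoplus_{n\ge 0}C_n$ by non-trivial subspaces, and for $N\ge 0$ set $B_N:=\bigoplus_{n\le N}C_n$. Let $T:V\to V$ be a linear operator. Assume: (1) each $C_n$ is finite dimensional and $\dim C_n>\sum_{m<n}\dim C_m$; (2) $T(C_0)\subseteq C_1$ and $T|_{C_0}:C_0\to C_1$ is injective; (3) for every $n\ge 1$, $T(C_n)\subseteq C_{n-1}\oplus C_n\oplus C_{n+1}$; (4) for every $N\ge 0$: if $f\in B_{N+1}$ and $T(f)\in B_{N+1}$, then $f\in B_N$. Then there exist non-empty subsets $A_n\subset C_n$ for all $n\ge 0$ such that for every $N\ge 0$ the sets $T^i(A_j)$ with $i,j\ge 0$, $i+j\le N$, are mutually disjoint and their union is a basis of $B_N$. Consequently, if $V$ is regarded as a module over the polynomial algebra $k[X]$ with $X$ acting by $T$, then $\bigsqcup_{n\ge 0}A_n$ is a module basis of $V$.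
   Context: Here $T^i(A_j)=\{T^i(a): a\in A_j\}$, with $T^0$ the identity. A module basis of a $k[X]$-module is a subset that freely generates the module. *)

theory Defs
  imports Complex_Main "HOL-Library.Set_Algebras" "HOL-Library.Disjoint_Sets"
    "HOL-Computational_Algebra.Polynomial"
begin

definition is_direct_sum_decomp ::
  "('k::field \<Rightarrow> 'v::ab_group_add \<Rightarrow> 'v) \<Rightarrow> (nat \<Rightarrow> 'v set) \<Rightarrow> bool"
where
  "is_direct_sum_decomp scale C \<longleftrightarrow>
     (\<forall>n. module.subspace scale (C n)) \<and>
     (\<forall>v. \<exists>!c. (\<forall>n. c n \<in> C n) \<and> finite {n. c n \<noteq> 0} \<and> v = (\<Sum>n | c n \<noteq> 0. c n))"

text \<open>
  Sums of subspaces are the sums of sets of \<^theory>\<open>HOL-Library.Set_Algebras\<close>; see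
  \<open>set_plus_def\<close> and \<open>set_sum_alt\<close>. Such sums of members of a direct sum decomposition
  with distinct indices are direct.
\<close>

definition partial_sum :: "(nat \<Rightarrow> 'v::ab_group_add set) \<Rightarrow> nat \<Rightarrow> 'v set" where
  "partial_sum C N = (\<Sum>n\<le>N. C n)"

text \<open>
  The library's \<open>dim\<close> is 0 for spaces of infinite dimension, so finite dimensionality has to be
  required separately.
\<close>

definition finite_dimensional ::
  "('k::field \<Rightarrow> 'v::ab_group_add \<Rightarrow> 'v) \<Rightarrow> 'v set \<Rightarrow> bool"
where
  "finite_dimensional scale W \<longleftrightarrow> (\<exists>S. finite S \<and> module.span scale S = W)"

text \<open>
  Used both for vector space bases of subspaces and for free generating sets of
  modules over \<open>k[X]\<close>.
\<close>

definition is_basis_of ::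
  "('r::comm_ring_1 \<Rightarrow> 'v::ab_group_add \<Rightarrow> 'v) \<Rightarrow> 'v set \<Rightarrow> 'v set \<Rightarrow> bool"
where
  "is_basis_of scale S W \<longleftrightarrow> \<not> module.dependent scale S \<and> module.span scale S = W"

definition poly_action ::
  "('k::field \<Rightarrow> 'v::ab_group_add \<Rightarrow> 'v) \<Rightarrow> ('v \<Rightarrow> 'v) \<Rightarrow> 'k poly \<Rightarrow> 'v \<Rightarrow> 'v"
where
  "poly_action scale T p v = (\<Sum>i\<le>degree p. scale (coeff p i) ((T ^^ i) v))"

context
  fixes scale :: "'k::field \<Rightarrow> 'v::ab_group_add \<Rightarrow> 'v" and T :: "'v \<Rightarrow> 'v"
  assumes lin: "Vector_Spaces.linear scale scale T"
begin

interpretation L: Vector_Spaces.linear scale scale T by (fact lin)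

lemma poly_action_altdef:
  assumes "degree p \<le> n"
  shows "poly_action scale T p v = (\<Sum>i\<le>n. scale (coeff p i) ((T ^^ i) v))"
  unfolding poly_action_def using assms
  by (intro sum.mono_neutral_left) (auto simp: coeff_eq_0)

lemma poly_action_0: "poly_action scale T 0 v = 0"
  by (simp add: poly_action_def)

lemma poly_action_1: "poly_action scale T 1 v = v"
  by (simp add: poly_action_def)

lemma poly_action_X: "poly_action scale T [:0, 1:] v = T v"
  by (simp add: poly_action_def)

lemma poly_action_add_left:
  "poly_action scale T (p + q) v = poly_action scale T p v + poly_action scale T q v"
proof -
  let ?n = "max (degree p) (degree q)"
  have "degree (p + q) \<le> ?n" by (rule degree_add_le) auto
  then show ?thesis
    by (simp add: poly_action_altdef[of _ ?n] L.vs1.scale_left_distrib sum.distrib)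
qed

lemma funpow_add_T: "(T ^^ i) (v + w) = (T ^^ i) v + (T ^^ i) w"
  by (induction i) (auto simp: L.add)

lemma poly_action_add_right:
  "poly_action scale T p (v + w) = poly_action scale T p v + poly_action scale T p w"
  by (simp add: poly_action_def funpow_add_T L.vs1.scale_right_distrib sum.distrib)

lemma poly_action_smult: "poly_action scale T (smult a p) v = scale a (poly_action scale T p v)"
  by (simp add: poly_action_altdef[of _ "degree p"] degree_smult_le L.vs1.scale_sum_right
      del: degree_smult_eq)

lemma poly_action_pCons_0: "poly_action scale T (pCons 0 p) v = T (poly_action scale T p v)"
proof -
  have "poly_action scale T (pCons 0 p) v =
      (\<Sum>i\<le>Suc (degree p). scale (coeff (pCons 0 p) i) ((T ^^ i) v))"
    by (rule poly_action_altdef) (rule degree_pCons_le)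
  also have "\<dots> = (\<Sum>i\<le>degree p. scale (coeff p i) (T ((T ^^ i) v)))"
    by (subst sum.atMost_Suc_shift) simp
  finally show ?thesis
    by (simp add: poly_action_def L.sum L.scale)
qed

lemma poly_action_mult:
  "poly_action scale T (p * q) v = poly_action scale T p (poly_action scale T q v)"
proof (induction p)
  case 0
  then show ?case by (simp add: poly_action_0)
next
  case (pCons a p)
  have "poly_action scale T (pCons a p) w = scale a w + T (poly_action scale T p w)" for w
  proof -
    have "pCons a p = smult a 1 + pCons 0 p" by simp
    then show ?thesis
      by (simp only: poly_action_add_left poly_action_smult poly_action_1 poly_action_pCons_0)
  qed
  then show ?case
    using pCons.IH by (simp add: poly_action_add_left poly_action_smult poly_action_pCons_0)
qed

lemma module_poly_action: "module (poly_action scale T)"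
  by standard
    (simp_all add: poly_action_add_left poly_action_add_right poly_action_mult poly_action_1)

end

end

theory Submission
  imports Defs
begin

text \<open>
  Put \<open>F n = C 0 + \<dots> + C (n - 1)\<close>, so that \<open>F 0 = {0}\<close> and \<open>partial_sum C N = F (N + 1)\<close>; with this
  shift the induction below starts from the zero space and treats \<open>C 0\<close> like the other summands. The hypotheses on \<open>T\<close> say that \<open>T\<close> maps \<open>F n\<close>
  into \<open>F (n + 1)\<close>, and does so strictly: an element of \<open>F (n + 1)\<close> whose image does not leave
  \<open>F (n + 1)\<close> already lies in \<open>F n\<close>. Hence \<open>T\<close> is injective, and it stays injective as a map
  from \<open>F (n + 1) / F n\<close> to \<open>F (n + 2) / F (n + 1)\<close>.

  The new generators at level \<open>n\<close> have to account for what \<open>F n\<close> and its image do not reach.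
  Accordingly \<open>A n\<close> is a set of vectors of \<open>C n\<close> that is a basis of a complement of
  \<open>W n = F n + T (F n)\<close> in \<open>F (n + 1)\<close>. Such a set is found by extending a basis of \<open>W n\<close> by
  vectors of \<open>C n\<close>, independently for each \<open>n\<close>. It is non-empty since
  \<open>dim (W n) \<le> 2 * dim (F n) < dim (F n) + dim (C n) = dim (F (n + 1))\<close>
  (\<open>not_F_subset_span_image\<close>).

  Let \<open>L n\<close> be the union of the sets \<open>T ^^ i ` A j\<close> with \<open>i + j = n\<close>. Then
  \<open>L (n + 1) = A (n + 1) \<union> T ` L n\<close>, and induction on \<open>n\<close> shows that \<open>L n\<close> is a basis of a complement
  of \<open>F n\<close> in \<open>F (n + 1)\<close>. The essential step is \<open>span_layer_Int_F\<close>: if \<open>a + T l\<close> lies in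
  \<open>F (n + 1)\<close>, with \<open>a\<close> in the span of \<open>A (n + 1)\<close> and \<open>l\<close> in the span of \<open>L n\<close>, then \<open>a\<close> lies in
  \<open>W (n + 1)\<close> and vanishes, and strictness forces \<open>l\<close> into \<open>F n\<close>, so \<open>l\<close> vanishes by induction.
  Therefore the layers up to \<open>N\<close> are disjoint and together form a basis of \<open>F (N + 1)\<close>.

  In the limit the elements \<open>(T ^^ i) a\<close>, for \<open>i\<close> a natural number and \<open>a\<close> in some \<open>A j\<close>, are
  pairwise distinct and form a basis of the whole space over the field. Since \<open>X ^ i\<close> acts as
  \<open>T ^^ i\<close>, this is the same as the \<open>A j\<close> together being a free generating set over the
  polynomial ring (\<open>poly_action_basis_if_funpow_basis\<close>).
\<close>

section \<open>Independent unions and complements\<close>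

lemma (in module) independent_Un_if_spans_meet_trivially:
  assumes "independent A" "independent B" "span A \<inter> span B \<subseteq> {0}"
  shows "independent (A \<union> B)"
  unfolding independent_explicit_module
proof (intro allI impI)
  fix t u v
  assume t: "finite t" "t \<subseteq> A \<union> B" "(\<Sum>v\<in>t. u v *s v) = 0" "v \<in> t"
  let ?x = "\<Sum>v\<in>t \<inter> A. u v *s v" and ?y = "\<Sum>v\<in>t - A. u v *s v"
  have "?x + ?y = 0"
    using t(1,3) by (metis sum.Int_Diff)
  moreover have x: "?x \<in> span A"
    by (intro span_sum span_scale span_base) auto
  moreover have "?y \<in> span B"
    using t(2) by (intro span_sum span_scale span_base) auto
  ultimately have "?x \<in> span B"
    by (metis add_eq_0_iff2 span_neg)
  with x assms(3) have x0: "?x = 0"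
    by auto
  with \<open>?x + ?y = 0\<close> have y0: "?y = 0"
    by simp
  show "u v = 0"
  proof (cases "v \<in> A")
    case True
    then show ?thesis
      using independentD[OF assms(1) _ _ x0, of v] t by auto
  next
    case False
    then show ?thesis
      using independentD[OF assms(2) _ _ y0, of v] t by auto
  qed
qed

lemma (in module) disjoint_if_spans_meet_trivially:
  assumes "0 \<notin> A" "span A \<inter> span B \<subseteq> {0}"
  shows "A \<inter> B = {}"
  using assms span_base by blast

text \<open>
  A vector in both spans has representations supported in \<open>A\<close> and in \<open>B\<close>; both are its
  representation over \<open>A \<union> B\<close>, so the support is empty.
\<close>
lemma (in vector_space) spans_meet_trivially_if_independent_Un:
  assumes "independent (A \<union> B)" "A \<inter> B = {}"
  shows "span A \<inter> span B = {0}"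
proof -
  have "x = 0" if x: "x \<in> span A" "x \<in> span B" for x
  proof -
    have "representation (A \<union> B) x = representation A x"
      "representation (A \<union> B) x = representation B x"
      using x assms(1) by (auto intro!: representation_extend)
    then have "representation (A \<union> B) x v = 0" for v
      using representation_ne_zero[of A x v] representation_ne_zero[of B x v] assms(2)
      by auto
    moreover have "x \<in> span (A \<union> B)"
      using x(1) span_mono[of A "A \<union> B"] by auto
    ultimately show "x = 0"
      using sum_nonzero_representation_eq[OF assms(1), of x] by simp
  qed
  then show ?thesis
    using span_zero by auto
qed

text \<open>
  Choosing the complement inside a prescribed set \<open>C\<close> is what later places the generators
  in the summands of the decomposition.
\<close>
lemma (in vector_space) independent_complement_exists:
  assumes "subspace W"
  obtains A where "A \<subseteq> C" "independent A" "span A \<inter> W = {0}" "C \<subseteq> span (A \<union> W)"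
proof -
  obtain S where S: "S \<subseteq> W" "independent S" "W \<subseteq> span S"
    by (rule maximal_independent_subset)
  then have spanS: "span S = W"
    using assms by (metis span_subspace)
  obtain B where B: "S \<subseteq> B" "B \<subseteq> S \<union> C" "independent B" "S \<union> C \<subseteq> span B"
    using maximal_independent_subset_extend[of S "S \<union> C"] S(2) by auto
  show thesis
  proof
    show "B - S \<subseteq> C"
      using B(2) by auto
    show "independent (B - S)"
      using B(3) by (rule independent_mono) auto
    have "(B - S) \<union> S = B"
      using B(1) by auto
    then show "span (B - S) \<inter> W = {0}"
      using spans_meet_trivially_if_independent_Un[of "B - S" S] B(3) spanS by auto
    have "span B \<subseteq> span ((B - S) \<union> W)"
      using S(1) by (intro span_mono) auto
    then show "C \<subseteq> span ((B - S) \<union> W)"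
      using B(4) by auto
  qed
qed

section \<open>Layers of total degree n\<close>

text \<open>
  The layer collects the images \<open>T ^^ i\<close> of \<open>A j\<close> with \<open>i + j = n\<close>. Ordering these sets by total
  degree turns the double family into a sequence that grows by the recursion
  \<open>layer_Suc\<close>, which is what the inductions below follow.
\<close>

definition layer :: "('v \<Rightarrow> 'v) \<Rightarrow> (nat \<Rightarrow> 'v set) \<Rightarrow> nat \<Rightarrow> 'v set" where
  "layer T A n = (\<Union>i\<le>n. (T ^^ i) ` A (n - i))"

lemma layer_0: "layer T A 0 = A 0"
  by (simp add: layer_def)

lemma layer_Suc: "layer T A (Suc n) = A (Suc n) \<union> T ` layer T A n"
proof -
  have "layer T A (Suc n) =
      A (Suc n) \<union> (\<Union>i\<le>n. (T ^^ Suc i) ` A (n - i))"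
    unfolding layer_def atMost_Suc_eq_insert_0 by (simp add: image_image)
  then show ?thesis
    by (simp add: layer_def image_UN image_image)
qed

lemma funpow_in_layer: "a \<in> A j \<Longrightarrow> (T ^^ i) a \<in> layer T A (i + j)"
  by (induction i) (cases j; auto simp: layer_0 layer_Suc)+

lemma UN_layer: "(\<Union>(i, j)\<in>{(i, j). i + j \<le> N}. (T ^^ i) ` A j) = (\<Union>n\<le>N. layer T A n)"
  (is "?L = ?R")
proof
  show "?L \<subseteq> ?R"
    by (auto intro!: bexI funpow_in_layer)
  show "?R \<subseteq> ?L"
  proof
    fix x assume "x \<in> ?R"
    then obtain n i where "n \<le> N" "i \<le> n" "x \<in> (T ^^ i) ` A (n - i)"
      by (auto simp: layer_def)
    then show "x \<in> ?L"
      by (intro UN_I[of "(i, n - i)"]) auto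
  qed
qed

section \<open>Strict filtrations\<close>

text \<open>
  Strictness means that \<open>T\<close> is injective on the associated graded space. The intended instance
  is the filtration by partial sums of a decomposition, indexed by the number of summands.
\<close>
locale strict_filtration = vector_space scale
  for scale :: "'k::field \<Rightarrow> 'v::ab_group_add \<Rightarrow> 'v" +
  fixes T :: "'v \<Rightarrow> 'v" and F :: "nat \<Rightarrow> 'v set"
  assumes linear_T: "Vector_Spaces.linear scale scale T"
    and subspace_F: "subspace (F n)"
    and F_0: "F 0 = {0}"
    and F_Suc: "F n \<subseteq> F (Suc n)"
    and T_F: "T ` F n \<subseteq> F (Suc n)"
    and strict: "f \<in> F (Suc n) \<Longrightarrow> T f \<in> F (Suc n) \<Longrightarrow> f \<in> F n"
    and F_exhaustive: "(\<Union>n. F n) = UNIV"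
begin

interpretation T: Vector_Spaces.linear scale scale T
  by (fact linear_T)

lemma F_mono: "m \<le> n \<Longrightarrow> F m \<subseteq> F n"
  using F_Suc by (rule lift_Suc_mono_le)

text \<open>By strictness, a kernel vector descends through the filtration down to \<open>F 0\<close>.\<close>
lemma inj_T: "inj T"
proof -
  have "f = 0" if "T f = 0" "f \<in> F n" for f n
    using that(2)
  proof (induction n)
    case 0
    then show ?case by (simp add: F_0)
  next
    case (Suc n)
    moreover have "T f \<in> F (Suc n)"
      using that(1) subspace_0[OF subspace_F] by simp
    ultimately show ?case
      by (blast intro: strict)
  qed
  then have "f = 0" if "T f = 0" for f
    using that F_exhaustive by blast
  then show ?thesis
    by (simp add: T.inj_iff_eq_0)
qed

definition W :: "nat \<Rightarrow> 'v set" where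
  "W n = span (F n \<union> T ` F n)"

lemma F_subset_W: "F n \<subseteq> W n"
  and T_F_subset_W: "T ` F n \<subseteq> W n"
  by (auto simp: W_def intro: span_base)

lemma subspace_W: "subspace (W n)"
  by (simp add: W_def)

lemma W_subset_F: "W n \<subseteq> F (Suc n)"
  unfolding W_def using F_Suc T_F by (intro span_minimal subspace_F) blast

end

section \<open>Bases adapted to a strict filtration\<close>

locale generating_complements = strict_filtration +
  fixes A :: "nat \<Rightarrow> 'b set"
  assumes A_subset: "A n \<subseteq> F (Suc n)"
    and independent_A: "independent (A n)"
    and A_Int_W: "span (A n) \<inter> W n = {0}"
    and A_W_spans: "F (Suc n) \<subseteq> span (A n \<union> W n)"
begin

interpretation T: Vector_Spaces.linear scale scale T
  by (fact linear_T)

abbreviation L :: "nat \<Rightarrow> 'b set" where "L \<equiv> layer T A"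

lemma layer_subset_F: "L n \<subseteq> F (Suc n)"
proof (induction n)
  case 0
  show ?case using A_subset by (simp add: layer_0)
next
  case (Suc n)
  have "T ` L n \<subseteq> F (Suc (Suc n))"
    using image_mono[OF Suc] T_F by (rule subset_trans)
  then show ?case
    using A_subset by (simp add: layer_Suc)
qed

lemma span_layer_subset_F: "span (L n) \<subseteq> F (Suc n)"
  using layer_subset_F subspace_F by (rule span_minimal)

lemma T_span_layer_subset_W: "T ` span (L n) \<subseteq> W (Suc n)"
  using image_mono[OF span_layer_subset_F] T_F_subset_W by (rule subset_trans)

lemma A_Int_T_layer: "span (A (Suc n)) \<inter> span (T ` L n) \<subseteq> {0}"
  using A_Int_W[of "Suc n"] T_span_layer_subset_W[of n]
  by (auto simp: T.span_image)

text \<open>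
  Modulo \<open>F (Suc n)\<close>, the elements of \<open>A (Suc n)\<close> are separated from \<open>T ` L n\<close> because they avoid
  \<open>W (Suc n)\<close>, and the latter are separated from zero because \<open>T\<close> is strict.
\<close>
lemma span_layer_Int_F: "span (L n) \<inter> F n = {0}"
proof (induction n)
  case 0
  show ?case using span_zero by (auto simp: F_0)
next
  case (Suc n)
  have "x = 0" if x: "x \<in> span (L (Suc n))" "x \<in> F (Suc n)" for x
  proof -
    obtain a l where al: "x = a + T l" "a \<in> span (A (Suc n))" "l \<in> span (L n)"
      using x(1) by (auto simp: layer_Suc span_Un T.span_image)
    have "x \<in> W (Suc n)" "T l \<in> W (Suc n)"
      using x(2) F_subset_W T_span_layer_subset_W al(3) by blast+
    then have "x - T l \<in> W (Suc n)"
      by (rule subspace_diff[OF subspace_W])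
    then have "a \<in> W (Suc n)"
      using al(1) by simp
    then have "a = 0"
      using al(2) A_Int_W by blast
    then have "T l \<in> F (Suc n)"
      using al(1) x(2) by simp
    then have "l \<in> F n"
      using al(3) span_layer_subset_F strict by blast
    then have "l = 0"
      using al(3) Suc by blast
    then show "x = 0"
      using al(1) \<open>a = 0\<close> by (simp add: T.zero)
  qed
  then show ?case
    using span_zero subspace_0[OF subspace_F] by blast
qed

lemma independent_layer: "independent (L n)"
proof (induction n)
  case 0
  show ?case using independent_A by (simp add: layer_0)
next
  case (Suc n)
  have "independent (T ` L n)"
    using Suc inj_T by (metis T.independent_injective_image inj_on_subset subset_UNIV)
  then show ?case
    unfolding layer_Suc using A_Int_T_layer independent_A
    by (intro independent_Un_if_spans_meet_trivially) auto
qed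

text \<open>
  The image \<open>T ` F n\<close> lies in the space spanned by the images of the layers below \<open>n\<close>, which are contained in
  layers with index at most \<open>n\<close>; so the span of these layers contains \<open>W n\<close>, and \<open>A n\<close> supplies the rest.
\<close>
lemma F_subset_span_layers: "F n \<subseteq> span (\<Union>m<n. L m)"
proof (induction n)
  case 0
  show ?case using span_zero by (simp add: F_0)
next
  case (Suc n)
  let ?S = "\<Union>m<Suc n. L m"
  have F: "F n \<subseteq> span ?S"
    using Suc span_mono[of "\<Union>m<n. L m" ?S] by force
  have "T ` (\<Union>m<n. L m) \<subseteq> ?S"
    by (force simp: layer_Suc)
  then have "span (T ` (\<Union>m<n. L m)) \<subseteq> span ?S"
    by (rule span_mono)
  then have "T ` F n \<subseteq> span ?S"
    using image_mono[OF Suc, of T] by (simp add: T.span_image)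
  with F have W: "W n \<subseteq> span ?S"
    unfolding W_def by (intro span_minimal) auto
  have "A n \<subseteq> ?S"
    by (cases n) (auto simp: layer_0 layer_Suc)
  then have "A n \<subseteq> span ?S"
    using span_superset by (rule subset_trans)
  with W have "span (A n \<union> W n) \<subseteq> span ?S"
    by (intro span_minimal) auto
  then show ?case
    using A_W_spans by (rule subset_trans[rotated])
qed

lemma span_layers: "span (\<Union>m<n. L m) = F n"
proof (rule span_subspace)
  show "(\<Union>m<n. L m) \<subseteq> F n"
  proof (rule UN_least)
    fix m assume "m \<in> {..<n}"
    then have "F (Suc m) \<subseteq> F n"
      by (intro F_mono) auto
    with layer_subset_F show "L m \<subseteq> F n"
      by (rule subset_trans)
  qed
qed (fact F_subset_span_layers subspace_F)+

lemma independent_layers: "independent (\<Union>m<n. L m)"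
proof (induction n)
  case 0
  show ?case by (simp add: independent_empty)
next
  case (Suc n)
  then have "independent (L n \<union> (\<Union>m<n. L m))"
    using independent_layer[of n] span_layer_Int_F[of n]
    by (intro independent_Un_if_spans_meet_trivially) (auto simp: span_layers)
  then show ?case
    by (simp add: lessThan_Suc)
qed

lemma layers_disjoint: "m < n \<Longrightarrow> L m \<inter> L n = {}"
proof -
  assume "m < n"
  then have "span (L m) \<subseteq> span (\<Union>m<n. L m)"
    by (intro span_mono) auto
  then have "span (L m) \<inter> span (L n) \<subseteq> {0}"
    using span_layer_Int_F[of n] by (auto simp: span_layers)
  moreover have "0 \<notin> L m"
    using independent_layer dependent_zero by blast
  ultimately show ?thesis
    by (intro disjoint_if_spans_meet_trivially)
qed

lemma layer_index_unique: "x \<in> L m \<Longrightarrow> x \<in> L n \<Longrightarrow> m = n"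
  using layers_disjoint[of m n] layers_disjoint[of n m] by (cases m n rule: linorder_cases) auto

lemma A_Int_T_layer_empty: "A (Suc n) \<inter> T ` L n = {}"
  using A_Int_T_layer independent_A dependent_zero
  by (intro disjoint_if_spans_meet_trivially) auto

text \<open>
  Cancelling the common power of the injective \<open>T\<close> leaves \<open>a = (T ^^ d) b\<close>. The layer of this
  element determines \<open>j = d + k\<close>, and \<open>d > 0\<close> is impossible since generators avoid the image
  of the preceding layer.
\<close>
lemma funpow_A_unique_le:
  assumes "a \<in> A j" "b \<in> A k" "(T ^^ i) a = (T ^^ l) b" "i \<le> l"
  shows "i = l \<and> j = k \<and> a = b"
proof -
  obtain d where d: "l = i + d"
    using assms(4) le_iff_add by auto
  have "inj (T ^^ i)"
    using inj_T by (rule inj_fn)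
  then have a: "a = (T ^^ d) b"
    using assms(3) by (auto simp: d funpow_add dest: injD)
  have "a \<in> L j"
    using funpow_in_layer[where T = T and i = 0] assms(1) by fastforce
  moreover have "a \<in> L (d + k)"
    unfolding a using assms(2) by (rule funpow_in_layer)
  ultimately have j: "j = d + k"
    by (rule layer_index_unique)
  have "d = 0"
  proof (rule ccontr)
    assume "d \<noteq> 0"
    then obtain e where e: "d = Suc e"
      by (cases d) auto
    have "a \<in> T ` L (e + k)"
      using a funpow_in_layer[where T = T and i = e] assms(2) by (auto simp: e)
    then show False
      using A_Int_T_layer_empty[of "e + k"] assms(1) by (auto simp: j e)
  qed
  then show ?thesis
    using a d j by simp
qed

lemma funpow_A_unique:
  assumes "a \<in> A j" "b \<in> A k" "(T ^^ i) a = (T ^^ l) b"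
  shows "i = l \<and> j = k \<and> a = b"
  using funpow_A_unique_le[OF assms] funpow_A_unique_le[OF assms(2,1) assms(3)[symmetric]]
  by (cases "i \<le> l") auto

lemma inj_on_funpow_A: "inj_on (\<lambda>(i, a). (T ^^ i) a) (UNIV \<times> (\<Union>n. A n))"
  by (auto intro!: inj_onI dest: funpow_A_unique)

lemma all_layers_eq: "(\<lambda>(i, a). (T ^^ i) a) ` (UNIV \<times> (\<Union>n. A n)) = (\<Union>N. \<Union>n<N. L n)"
proof
  show "(\<lambda>(i, a). (T ^^ i) a) ` (UNIV \<times> (\<Union>n. A n)) \<subseteq> (\<Union>N. \<Union>n<N. L n)"
    by (auto intro!: exI bexI funpow_in_layer)
  show "(\<Union>N. \<Union>n<N. L n) \<subseteq> (\<lambda>(i, a). (T ^^ i) a) ` (UNIV \<times> (\<Union>n. A n))"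
    by (force simp: layer_def)
qed

lemma is_basis_of_all_layers:
  "is_basis_of scale ((\<lambda>(i, a). (T ^^ i) a) ` (UNIV \<times> (\<Union>n. A n))) UNIV"
proof -
  have "independent (\<Union>N. \<Union>n<N. L n)"
  proof (rule independent_Union_directed)
    fix c d assume "c \<in> range (\<lambda>N. \<Union>n<N. L n)" "d \<in> range (\<lambda>N. \<Union>n<N. L n)"
    then obtain M N where "c = (\<Union>n<M. L n)" "d = (\<Union>n<N. L n)"
      by auto
    then show "c \<subseteq> d \<or> d \<subseteq> c"
      by (cases "M \<le> N") (force intro: less_le_trans)+
  qed (auto simp: independent_layers)
  moreover have "F N \<subseteq> span (\<Union>N. \<Union>n<N. L n)" for N
    unfolding span_layers[symmetric] by (intro span_mono) auto
  then have "span (\<Union>N. \<Union>n<N. L n) = UNIV"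
    using F_exhaustive by blast
  ultimately show ?thesis
    by (simp add: is_basis_of_def all_layers_eq)
qed

end

section \<open>Module bases over the polynomial ring\<close>

text \<open>
  Applying polynomials \<open>u w\<close> to the elements \<open>w\<close> of a finite set and adding up gives the linear
  combination of the vectors \<open>(T ^^ i) w\<close> with coefficients \<open>coeff (u w) i\<close>. Injectivity of
  \<open>(i, w) \<mapsto> (T ^^ i) w\<close> keeps coefficients of different pairs from being merged.
\<close>
lemma poly_action_basis_if_funpow_basis:
  fixes scale :: "'k::field \<Rightarrow> 'v::ab_group_add \<Rightarrow> 'v" and G :: "'v set"
  assumes lin: "Vector_Spaces.linear scale scale T"
    and inj: "inj_on (\<lambda>(i, a). (T ^^ i) a) (UNIV \<times> G)"
    and basis: "is_basis_of scale ((\<lambda>(i, a). (T ^^ i) a) ` (UNIV \<times> G)) UNIV"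
  shows "is_basis_of (poly_action scale T) G UNIV"
proof -
  let ?p = "\<lambda>(i, a). (T ^^ i) a"
  interpret L: Vector_Spaces.linear scale scale T by (fact lin)
  interpret M: module "poly_action scale T"
    using lin by (rule module_poly_action)
  have const: "poly_action scale T [:c:] v = scale c v" for c v
    by (simp add: poly_action_def)
  have monom: "poly_action scale T (monom 1 i) v = (T ^^ i) v" for i v
    using poly_action_altdef[OF lin degree_monom_le, of "1::'k" i v]
    by (simp add: if_distrib[of "\<lambda>c. scale c _"] cong: if_cong)
  have "M.independent G"
    unfolding M.independent_explicit_module
  proof (intro allI impI)
    fix t u v
    assume t: "finite t" "t \<subseteq> G" "(\<Sum>v\<in>t. poly_action scale T (u v) v) = 0" "v \<in> t"
    define d where "d = Max (degree ` u ` t)"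
    have d: "degree (u w) \<le> d" if "w \<in> t" for w
      unfolding d_def using t(1) that by (intro Max_ge) auto
    let ?I = "{..d} \<times> t"
    have inj': "inj_on ?p ?I"
      using inj by (rule inj_on_subset) (use t(2) in auto)
    \<comment> \<open>Independence speaks of coefficients indexed by vectors, so the pair is recovered from its vector.\<close>
    define c where "c x = (case inv_into ?I ?p x of (i, w) \<Rightarrow> coeff (u w) i)" for x
    have c: "c ((T ^^ i) w) = coeff (u w) i" if "i \<le> d" "w \<in> t" for i w
      using inv_into_f_f[OF inj', of "(i, w)"] that by (simp add: c_def)
    have "(\<Sum>x\<in>?p ` ?I. scale (c x) x) = (\<Sum>(i, w)\<in>?I. scale (c ((T ^^ i) w)) ((T ^^ i) w))"
      by (subst sum.reindex[OF inj']) (auto simp: case_prod_unfold)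
    also have "\<dots> = (\<Sum>i\<le>d. \<Sum>w\<in>t. scale (coeff (u w) i) ((T ^^ i) w))"
      by (subst sum.cartesian_product[symmetric]) (simp add: c)
    also have "\<dots> = (\<Sum>w\<in>t. poly_action scale T (u w) w)"
      by (subst sum.swap) (simp add: poly_action_altdef[OF lin d])
    finally have zero: "(\<Sum>x\<in>?p ` ?I. scale (c x) x) = 0"
      using t(3) by simp
    have "coeff (u v) i = 0" for i
    proof (cases "i \<le> d")
      case True
      have "c ((T ^^ i) v) = 0"
      proof (rule L.vs1.independentD[OF _ _ _ zero])
        show "L.vs1.independent (?p ` (UNIV \<times> G))"
          using basis by (simp add: is_basis_of_def)
        show "(T ^^ i) v \<in> ?p ` ?I"
          using True t(4) by force
      qed (use t(1,2) in auto)
      then show ?thesis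
        using c[OF True t(4)] by simp
    next
      case False
      then show ?thesis
        using d[OF t(4)] by (simp add: coeff_eq_0)
    qed
    then show "u v = 0"
      by (simp add: poly_eq_iff)
  qed
  moreover have "M.span G = UNIV"
  proof -
    have "L.vs1.subspace (M.span G)"
      using M.span_scale[of _ G "[:_:]"]
      by (auto simp: const intro!: L.vs1.subspaceI M.span_zero M.span_add)
    moreover have "?p ` (UNIV \<times> G) \<subseteq> M.span G"
      using M.span_scale[OF M.span_base, of _ G "monom 1 _"] by (auto simp: monom)
    ultimately have "L.vs1.span (?p ` (UNIV \<times> G)) \<subseteq> M.span G"
      by (intro L.vs1.span_minimal)
    then show ?thesis
      using basis by (auto simp: is_basis_of_def)
  qed
  ultimately show ?thesis
    by (simp add: is_basis_of_def)
qed

section \<open>Partial sums of a direct sum decomposition\<close>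

locale direct_sum_decomposition = vector_space scale
  for scale :: "'k::field \<Rightarrow> 'v::ab_group_add \<Rightarrow> 'v" +
  fixes C :: "nat \<Rightarrow> 'v set"
  assumes decomp: "is_direct_sum_decomp scale C"
begin

lemma subspace_C: "subspace (C n)"
  using decomp by (simp add: is_direct_sum_decomp_def)

abbreviation F :: "nat \<Rightarrow> 'v set" where "F n \<equiv> \<Sum>m<n. C m"

lemma F_0: "F 0 = {0}"
  by simp

lemma F_Suc_eq: "F (Suc n) = F n + C n"
  by (simp add: add.commute)

lemma subspace_F: "subspace (F n)"
proof (induction n)
  case 0
  show ?case by (simp add: subspace_single_0)
next
  case (Suc n)
  have "F n + C n = {x + y |x y. x \<in> F n \<and> y \<in> C n}"
    by (auto simp: set_plus_def)
  then show ?case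
    unfolding F_Suc_eq using subspace_sums[OF Suc subspace_C] by simp
qed

lemma F_subset_Suc: "F n \<subseteq> F (Suc n)"
  unfolding F_Suc_eq using subspace_0[OF subspace_C[of n]]
  by (subst add.commute) (rule set_zero_plus2)

lemma C_subset_F: "C n \<subseteq> F (Suc n)"
  unfolding F_Suc_eq using subspace_0[OF subspace_F[of n]] by (rule set_zero_plus2)

lemma F_subset: "m \<le> n \<Longrightarrow> F m \<subseteq> F n"
  using F_subset_Suc by (rule lift_Suc_mono_le)

lemma C_subset_F_if_less: "m < n \<Longrightarrow> C m \<subseteq> F n"
  using C_subset_F[of m] F_subset[of "Suc m" n] by auto

text \<open>
  A common element has two decompositions: one with components below \<open>n\<close> only, and one
  with a single component at \<open>n\<close>. Uniqueness makes that component zero.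
\<close>
lemma F_Int_C: "F n \<inter> C n \<subseteq> {0}"
proof
  fix x assume x: "x \<in> F n \<inter> C n"
  then obtain s where s: "x = sum s {..<n}" "\<forall>m<n. s m \<in> C m"
    by (auto simp: set_sum_alt)
  define c where "c m = (if m < n then s m else 0)" for m
  define e where "e m = (if m = n then x else 0)" for m
  have 0: "0 \<in> C m" for m
    using subspace_C by (rule subspace_0)
  have "{m. c m \<noteq> 0} \<subseteq> {..<n}"
    by (auto simp: c_def)
  moreover from this have "sum c {m. c m \<noteq> 0} = sum c {..<n}"
    by (intro sum.mono_neutral_left) auto
  ultimately have c: "(\<forall>m. c m \<in> C m) \<and> finite {m. c m \<noteq> 0} \<and> x = (\<Sum>m | c m \<noteq> 0. c m)"
    using s 0 finite_subset[of _ "{..<n}"] by (auto simp: c_def)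
  have "{m. e m \<noteq> 0} \<subseteq> {n}"
    by (auto simp: e_def)
  moreover from this have "sum e {m. e m \<noteq> 0} = sum e {n}"
    by (intro sum.mono_neutral_left) auto
  ultimately have e: "(\<forall>m. e m \<in> C m) \<and> finite {m. e m \<noteq> 0} \<and> x = (\<Sum>m | e m \<noteq> 0. e m)"
    using x 0 finite_subset[of _ "{n}"] by (auto simp: e_def)
  have "c = e"
    using decomp c e unfolding is_direct_sum_decomp_def by blast
  then have "c n = e n"
    by simp
  then show "x \<in> {0}"
    by (simp add: c_def e_def)
qed

lemma UN_F: "(\<Union>n. F n) = UNIV"
proof -
  have "v \<in> (\<Union>n. F n)" for v
  proof -
    obtain c where c: "\<forall>n. c n \<in> C n" "finite {n. c n \<noteq> 0}" "v = (\<Sum>n | c n \<noteq> 0. c n)"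
      using decomp unfolding is_direct_sum_decomp_def by blast
    obtain N where N: "\<forall>n\<in>{n. c n \<noteq> 0}. n < N"
      using c(2) finite_nat_set_iff_bounded by auto
    have "v \<in> F N"
      unfolding c(3) using N c(1) C_subset_F_if_less by (intro subspace_sum[OF subspace_F]) blast
    then show ?thesis
      by blast
  qed
  then show ?thesis
    by blast
qed

lemma finite_basis_F:
  assumes fin: "\<And>n. finite_dimensional scale (C n)"
  shows "\<exists>S. finite S \<and> independent S \<and> span S = F n \<and> card S = (\<Sum>m<n. dim (C m))"
proof (induction n)
  case 0
  show ?case
    by (rule exI[of _ "{}"]) (auto simp: independent_empty)
next
  case (Suc n)
  then obtain S where S: "finite S" "independent S" "span S = F n" "card S = (\<Sum>m<n. dim (C m))"
    by blast
  obtain B where B: "B \<subseteq> C n" "independent B" "C n \<subseteq> span B" "card B = dim (C n)"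
    by (rule basis_exists)
  have spanB: "span B = C n"
    using B(1,3) subspace_C by (rule span_subspace)
  obtain G where "finite G" "span G = C n"
    using fin by (auto simp: finite_dimensional_def)
  then have "finite B"
    using independent_span_bound[of G B] B(1,2) by simp
  have meet: "span S \<inter> span B \<subseteq> {0}"
    using F_Int_C by (simp add: S(3) spanB)
  have "0 \<notin> S"
    using S(2) dependent_zero by blast
  then have "S \<inter> B = {}"
    using meet by (rule disjoint_if_spans_meet_trivially)
  then have "card (S \<union> B) = (\<Sum>m<Suc n. dim (C m))"
    using S(1,4) B(4) \<open>finite B\<close> by (simp add: card_Un_disjoint)
  moreover have "independent (S \<union> B)"
    using S(2) B(2) meet by (rule independent_Un_if_spans_meet_trivially)
  moreover have "span (S \<union> B) = F (Suc n)"
    unfolding span_Un S(3) spanB F_Suc_eq by (auto simp: set_plus_def)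
  ultimately show ?case
    using S(1) \<open>finite B\<close> by blast
qed

text \<open>
  The span on the right has dimension at most twice that of \<open>F n\<close>, while \<open>F (Suc n)\<close> exceeds
  this because \<open>C n\<close> alone is larger than \<open>F n\<close>.
\<close>
lemma not_F_subset_span_image:
  assumes lin: "Vector_Spaces.linear scale scale T"
    and fin: "\<And>n. finite_dimensional scale (C n)"
    and dim: "dim (C n) > (\<Sum>m<n. dim (C m))"
  shows "\<not> F (Suc n) \<subseteq> span (F n \<union> T ` F n)"
proof
  assume sub: "F (Suc n) \<subseteq> span (F n \<union> T ` F n)"
  interpret T: Vector_Spaces.linear scale scale T by (fact lin)
  obtain S where S: "finite S" "span S = F n" "card S = (\<Sum>m<n. dim (C m))"
    using finite_basis_F[OF fin] by blast
  obtain R where R: "independent R" "span R = F (Suc n)" "card R = (\<Sum>m<Suc n. dim (C m))"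
    using finite_basis_F[OF fin] by blast
  have "F n \<union> T ` F n \<subseteq> span (S \<union> T ` S)"
    using span_mono[of S "S \<union> T ` S"] span_mono[of "T ` S" "S \<union> T ` S"]
    by (simp add: S(2) T.span_image)
  then have "span (F n \<union> T ` F n) \<subseteq> span (S \<union> T ` S)"
    by (intro span_minimal) auto
  with sub have "R \<subseteq> span (S \<union> T ` S)"
    using R(2) span_superset by blast
  then have "card R \<le> card (S \<union> T ` S)"
    using independent_span_bound[of "S \<union> T ` S" R] R(1) S(1) by simp
  also have "\<dots> \<le> card S + card S"
    using card_Un_le[of S "T ` S"] card_image_le[OF S(1), of T] by linarith
  finally show False
    using dim by (simp add: R(3) S(3))
qed

lemma image_F_subset:
  assumes lin: "Vector_Spaces.linear scale scale T"
    and base: "T ` C 0 \<subseteq> C 1"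
    and step: "\<And>n. n \<ge> 1 \<Longrightarrow> T ` C n \<subseteq> C (n - 1) + C n + C (n + 1)"
  shows "T ` F n \<subseteq> F (Suc n)"
proof (induction n)
  case 0
  interpret T: Vector_Spaces.linear scale scale T by (fact lin)
  show ?case
    using subspace_0[OF subspace_F[of 1]] by (simp add: T.zero)
next
  case (Suc n)
  interpret T: Vector_Spaces.linear scale scale T by (fact lin)
  have C: "T ` C n \<subseteq> F (Suc (Suc n))"
  proof (cases n)
    case 0
    then show ?thesis
      using base C_subset_F[of 1] by auto
  next
    case (Suc m)
    then have "T ` C n \<subseteq> C m + C n + C (Suc n)"
      using step[of n] by simp
    moreover have "C m \<subseteq> F (Suc (Suc n))" "C n \<subseteq> F (Suc (Suc n))" "C (Suc n) \<subseteq> F (Suc (Suc n))"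
      using Suc by (auto intro!: C_subset_F_if_less simp del: sum.lessThan_Suc)
    ultimately show ?thesis
      using subspace_add[OF subspace_F[of "Suc (Suc n)"]]
      by (elim subset_trans) (blast elim!: set_plus_elim)
  qed
  have F: "T ` F n \<subseteq> F (Suc (Suc n))"
    using Suc F_subset_Suc by (rule subset_trans)
  show ?case
  proof
    fix y assume "y \<in> T ` F (Suc n)"
    then obtain a b where "y = T a + T b" "a \<in> F n" "b \<in> C n"
      unfolding F_Suc_eq by (auto elim!: set_plus_elim simp: T.add)
    then show "y \<in> F (Suc (Suc n))"
      using C F subspace_add[OF subspace_F[of "Suc (Suc n)"]] by blast
  qed
qed

end

section \<open>Existence of free generators\<close>

theorem mainTheorem2:
  fixes scale :: "'k::field \<Rightarrow> 'v::ab_group_add \<Rightarrow> 'v"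
    and C :: "nat \<Rightarrow> 'v set"
    and T :: "'v \<Rightarrow> 'v"
  assumes "vector_space scale"
    and "is_direct_sum_decomp scale C"
    and "\<And>n. C n \<noteq> {0}"
    and "Vector_Spaces.linear scale scale T"
    and "\<And>n. finite_dimensional scale (C n)"
    and "\<And>n. vector_space.dim scale (C n) > (\<Sum>m<n. vector_space.dim scale (C m))"
    and "T ` C 0 \<subseteq> C 1"
    and "inj_on T (C 0)"
    and "\<And>n. n \<ge> 1 \<Longrightarrow> T ` C n \<subseteq> C (n - 1) + C n + C (n + 1)"
    and "\<And>N f. f \<in> partial_sum C (N + 1) \<Longrightarrow> T f \<in> partial_sum C (N + 1) \<Longrightarrow>
           f \<in> partial_sum C N"
  shows "\<exists>A :: nat \<Rightarrow> 'v set.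
    (\<forall>n. A n \<noteq> {} \<and> A n \<subseteq> C n) \<and>
    (\<forall>N. disjoint_family_on (\<lambda>(i, j). (T ^^ i) ` A j) {(i, j). i + j \<le> N} \<and>
         is_basis_of scale (\<Union>(i, j)\<in>{(i, j). i + j \<le> N}. (T ^^ i) ` A j) (partial_sum C N)) \<and>
    disjoint_family A \<and>
    is_basis_of (poly_action scale T) (\<Union>n. A n) UNIV"
proof -
  interpret direct_sum_decomposition scale C
    using assms(1,2) by (simp add: direct_sum_decomposition_def direct_sum_decomposition_axioms_def)
  have partial_sum: "partial_sum C N = F (Suc N)" for N
    by (simp add: partial_sum_def lessThan_Suc_atMost del: sum.lessThan_Suc)
  \<comment> \<open>The bottom case of strictness: \<open>T f\<close> lies in both \<open>C 0\<close> and \<open>C 1\<close>, so it vanishes.\<close>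
  have strict0: "f \<in> F 0" if "f \<in> F (Suc 0)" "T f \<in> F (Suc 0)" for f
  proof -
    interpret T: Vector_Spaces.linear scale scale T by (fact assms(4))
    have f: "f \<in> C 0" and "T f \<in> F 1"
      using that by simp_all
    then have "T f \<in> F 1 \<inter> C 1"
      using assms(7) by blast
    then have "T f = T 0"
      using F_Int_C[of 1] by (auto simp: T.zero)
    then show ?thesis
      using inj_onD[OF assms(8) _ f subspace_0[OF subspace_C]] by simp
  qed
  have strict: "f \<in> F n" if "f \<in> F (Suc n)" "T f \<in> F (Suc n)" for f n
  proof (cases n)
    case 0
    then show ?thesis using strict0 that by simp
  next
    case (Suc m)
    then show ?thesis using assms(10)[of f m] that by (simp add: partial_sum)
  qed
  have T_F: "T ` F n \<subseteq> F (Suc n)" for n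
    using assms(4,7,9) by (rule image_F_subset)
  interpret strict_filtration scale T F
    by (intro strict_filtration.intro strict_filtration_axioms.intro)
      (fact assms(1,4) subspace_F F_0 F_subset_Suc UN_F T_F strict)+
  have "\<exists>A. A \<subseteq> C n \<and> independent A \<and> span A \<inter> W n = {0} \<and> C n \<subseteq> span (A \<union> W n)" for n
    using independent_complement_exists[OF subspace_W] by metis
  then obtain A where A: "\<And>n. A n \<subseteq> C n" "\<And>n. independent (A n)"
      "\<And>n. span (A n) \<inter> W n = {0}" "\<And>n. C n \<subseteq> span (A n \<union> W n)"
    by metis
  interpret generating_complements scale T F A
  proof
    fix n
    show "A n \<subseteq> F (Suc n)"
      using A(1) C_subset_F by (rule subset_trans)
    have "F n \<subseteq> span (A n \<union> W n)"
      using F_subset_W[of n] span_superset[of "A n \<union> W n"] by blast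
    with A(4) show "F (Suc n) \<subseteq> span (A n \<union> W n)"
      unfolding F_Suc_eq by (auto elim!: set_plus_elim intro: span_add)
  qed (fact A)+
  have nonempty: "A n \<noteq> {}" for n
  proof
    assume "A n = {}"
    then have "F (Suc n) \<subseteq> span (W n)"
      using A_W_spans[of n] by simp
    then show False
      using not_F_subset_span_image[OF assms(4,5,6)] by (simp add: W_def span_span)
  qed
  show ?thesis
  proof (intro exI[of _ A] conjI allI)
    show "A n \<noteq> {}" "A n \<subseteq> C n" for n
      by (fact nonempty A(1))+
    show "disjoint_family_on (\<lambda>(i, j). (T ^^ i) ` A j) {(i, j). i + j \<le> N}" for N
      by (auto simp: disjoint_family_on_def dest: funpow_A_unique)
    show "is_basis_of scale (\<Union>(i, j)\<in>{(i, j). i + j \<le> N}. (T ^^ i) ` A j) (partial_sum C N)" for N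
      unfolding UN_layer partial_sum using independent_layers[of "Suc N"] span_layers[of "Suc N"]
      by (simp add: is_basis_of_def lessThan_Suc_atMost del: sum.lessThan_Suc)
    show "disjoint_family A"
      using funpow_A_unique[where i = 0 and l = 0] by (auto simp: disjoint_family_on_def)
    show "is_basis_of (poly_action scale T) (\<Union>n. A n) UNIV"
      using assms(4) inj_on_funpow_A is_basis_of_all_layers
      by (rule poly_action_basis_if_funpow_basis)
  qed
qed

end
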